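(* Let $G$ be a connected graph with a colouring $\omega$ that uses exactly $c$ colours on $G$. Then $m(G,\omega)\ge c-1$. Moreover, if every colour used by $\omega$ appears in at least two distinct monochromatic components of $G$ with respect to $\omega$, then $m(G,\omega)\ge c$.
   Context: All graphs are finite and simple. The (free) Flood-It game: let $G=(V,E)$ be a graph with a colouring $\omega:V\to C$, not necessarily proper, where $C$ is a finite colour-set. A monochromatic component is a maximal set of vertices of one colour inducing a connected subgraph. A move $(v,d)$, with $v\in V$ and $d\in C$, recolours with colour $d$ every vertex in the monochromatic component (with respect to the current colouring) containing $v$. For $d\in C$, $m(G,\omega,d)$ is the minimum number of moves needed, starting from $\omega$, to give all vertices of $G$ colour $d$, and $m(G,\omega)=\min_{d\in C}m(G,\omega,d)$. *)

theory Defs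
  imports Main "Graph_Theory.Digraph_Component"
begin

text \<open>
  A finite simple graph is a \<open>graph\<close> of the Graph_Theory entry: a finite, loop-free, symmetric
  digraph without parallel arcs. Its \<open>connected\<close> requires a nonempty vertex set, so
  monochromatic components are nonempty. A colouring is a total function of which only the
  values on \<open>verts G\<close> matter.
\<close>

definition mono_connected :: "('a, 'b) pre_digraph \<Rightarrow> ('a \<Rightarrow> 'c) \<Rightarrow> 'a set \<Rightarrow> bool" where
  "mono_connected G \<omega> S \<longleftrightarrow>
     S \<subseteq> verts G \<and> (\<exists>d. \<forall>u\<in>S. \<omega> u = d) \<and> Digraph_Component.connected (G \<restriction> S)"

definition mono_component :: "('a, 'b) pre_digraph \<Rightarrow> ('a \<Rightarrow> 'c) \<Rightarrow> 'a set \<Rightarrow> bool" where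
  "mono_component G \<omega> S \<longleftrightarrow>
     mono_connected G \<omega> S \<and> (\<forall>T. mono_connected G \<omega> T \<and> S \<subseteq> T \<longrightarrow> T = S)"

definition flood_move :: "('a, 'b) pre_digraph \<Rightarrow> 'a \<times> 'c \<Rightarrow> ('a \<Rightarrow> 'c) \<Rightarrow> 'a \<Rightarrow> 'c" where
  "flood_move G = (\<lambda>(v, d) \<omega> u.
     if \<exists>S. mono_component G \<omega> S \<and> v \<in> S \<and> u \<in> S then d else \<omega> u)"

definition floods_to ::
  "'c set \<Rightarrow> ('a, 'b) pre_digraph \<Rightarrow> ('a \<Rightarrow> 'c) \<Rightarrow> 'c \<Rightarrow> ('a \<times> 'c) list \<Rightarrow> bool" where
  "floods_to C G \<omega> d ms \<longleftrightarrow>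
     set ms \<subseteq> verts G \<times> C \<and> (\<forall>u \<in> verts G. fold (flood_move G) ms \<omega> u = d)"

text \<open>
  Every colouring of a connected graph can be flooded to every colour, so the minimum below
  exists for connected \<open>G\<close>; otherwise it may be unspecified.
\<close>

definition min_moves_to ::
  "'c set \<Rightarrow> ('a, 'b) pre_digraph \<Rightarrow> ('a \<Rightarrow> 'c) \<Rightarrow> 'c \<Rightarrow> nat" where
  "min_moves_to C G \<omega> d = (LEAST k. \<exists>ms. length ms = k \<and> floods_to C G \<omega> d ms)"

definition min_moves :: "'c set \<Rightarrow> ('a, 'b) pre_digraph \<Rightarrow> ('a \<Rightarrow> 'c) \<Rightarrow> nat" where
  "min_moves C G \<omega> = Min ((\<lambda>d. min_moves_to C G \<omega> d) ` C)"

end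

theory Submission
  imports Defs
begin

text \<open>
  A move recolours vertices of one colour only, so it removes at most one colour from the palette
  in use; since a single colour is left at the end, at least \<open>c - 1\<close> moves are needed. If every
  colour occurs in two components, the first move leaves the palette at least as large, which
  costs one more move. As the minimum is a \<open>LEAST\<close>, these bounds are only meaningful once some
  flooding sequence is known to exist: keep playing at a fixed vertex, each time choosing the
  colour of a neighbour of its component.
\<close>

section \<open>Connected induced subgraphs\<close>

lemma connected_induce_iff:
  "Digraph_Component.connected (G \<restriction> S) \<longleftrightarrow>
     S \<noteq> {} \<and> (\<forall>u\<in>S. \<forall>v\<in>S. (u, v) \<in> rtrancl_on S ((arcs_ends (G \<restriction> S))\<^sup>s))"
  by (simp add: connected_conv)

lemma symcl_arcs_ends_induce_mono:
  assumes "S \<subseteq> T"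
  shows "(arcs_ends (G \<restriction> S))\<^sup>s \<subseteq> (arcs_ends (G \<restriction> T))\<^sup>s"
proof -
  have "arcs_ends (G \<restriction> S) \<subseteq> arcs_ends (G \<restriction> T)"
    using assms by (auto simp: arcs_ends_def)
  then show ?thesis unfolding symcl_def by blast
qed

lemma connected_induce_Un:
  assumes "Digraph_Component.connected (G \<restriction> S)" "Digraph_Component.connected (G \<restriction> T)"
    and "S \<inter> T \<noteq> {}"
  shows "Digraph_Component.connected (G \<restriction> (S \<union> T))"
proof -
  let ?R = "rtrancl_on (S \<union> T) ((arcs_ends (G \<restriction> (S \<union> T)))\<^sup>s)"
  obtain w where w: "w \<in> S" "w \<in> T" using assms(3) by blast
  \<comment> \<open>Walks inside \<open>S\<close> or inside \<open>T\<close> remain walks in the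
    union, so the common vertex \<open>w\<close> serves as a hub: any two vertices are joined
    through it.\<close>
  have "rtrancl_on A ((arcs_ends (G \<restriction> A))\<^sup>s) \<subseteq> ?R" if "A \<subseteq> S \<union> T" for A
    using rtrancl_on_mono[OF symcl_arcs_ends_induce_mono[OF that, of G] that] by auto
  then have "(u, w) \<in> ?R \<and> (w, u) \<in> ?R" if "u \<in> S \<union> T" for u
    using that w assms(1,2) unfolding connected_induce_iff by blast
  then have "(u, v) \<in> ?R" if "u \<in> S \<union> T" "v \<in> S \<union> T" for u v
    using that by (meson rtrancl_on_trans)
  then show ?thesis
    using w unfolding connected_induce_iff by blast
qed

lemma connected_induce_singleton:
  "Digraph_Component.connected (G \<restriction> {v})"
  by (simp add: connected_induce_iff)

lemma connected_induce_adjacent: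
  assumes "(x, y) \<in> (arcs_ends G)\<^sup>s"
  shows "Digraph_Component.connected (G \<restriction> {x, y})"
proof -
  let ?R = "(arcs_ends (G \<restriction> {x, y}))\<^sup>s"
  have "(x, y) \<in> ?R" "(y, x) \<in> ?R"
    using assms by (auto simp: arcs_ends_conv symcl_def)
  then have "(x, y) \<in> rtrancl_on {x, y} ?R" "(y, x) \<in> rtrancl_on {x, y} ?R"
    by (auto intro: rtrancl_on_into_rtrancl_on)
  then show ?thesis
    unfolding connected_induce_iff by auto
qed

lemma (in wf_digraph) induce_verts: "G \<restriction> verts G = G"
  by (auto simp: induce_subgraph_def intro!: pre_digraph.equality)

lemma connected_boundary_edge:
  assumes "Digraph_Component.connected G" "S \<subseteq> verts G" "S \<noteq> {}" "S \<noteq> verts G"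
  obtains x y where "x \<in> S" "y \<in> verts G - S" "(x, y) \<in> (arcs_ends G)\<^sup>s"
proof -
  obtain u v where uv: "u \<in> S" "v \<in> verts G - S" using assms by blast
  then have "(u, v) \<in> rtrancl_on (verts G) ((arcs_ends G)\<^sup>s)"
    using assms by (auto simp: connected_conv)
  \<comment> \<open>Invariant along a walk from \<open>u\<close>: its current end lies in
    \<open>S\<close>, or an edge leaving \<open>S\<close> exists.\<close>
  then have "v \<in> S \<or> (\<exists>x\<in>S. \<exists>y\<in>verts G - S. (x, y) \<in> (arcs_ends G)\<^sup>s)"
    by (induction rule: rtrancl_on_induct) (use uv in auto)
  with uv that show ?thesis by blast
qed

section \<open>Monochromatic components\<close>

lemma mono_connected_Un:
  assumes "mono_connected G \<omega> S" "mono_connected G \<omega> T" "S \<inter> T \<noteq> {}"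
  shows "mono_connected G \<omega> (S \<union> T)"
proof -
  obtain w a b where "w \<in> S" "w \<in> T" "\<forall>u\<in>S. \<omega> u = a" "\<forall>u\<in>T. \<omega> u = b"
    using assms by (auto simp: mono_connected_def)
  then have "\<forall>u\<in>S \<union> T. \<omega> u = \<omega> w" by auto
  then show ?thesis
    using assms connected_induce_Un[of G S T] by (auto simp: mono_connected_def)
qed

text \<open>The union of two overlapping components is again monochromatic and connected, so
  maximality makes each of them equal to it.\<close>

lemma mono_component_unique:
  assumes "mono_component G \<omega> S" "mono_component G \<omega> T" "v \<in> S" "v \<in> T"
  shows "S = T"
  using assms mono_connected_Un[of G \<omega> S T] unfolding mono_component_def
  by (metis Un_upper1 Un_upper2 disjoint_iff)

lemma mono_connected_imp_subset_component:
  assumes "finite (verts G)" "mono_connected G \<omega> S"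
  obtains T where "mono_component G \<omega> T" "S \<subseteq> T"
proof -
  let ?F = "{T. mono_connected G \<omega> T \<and> S \<subseteq> T}"
  have "finite ?F"
    by (rule finite_subset[of _ "Pow (verts G)"]) (use assms in \<open>auto simp: mono_connected_def\<close>)
  moreover have "S \<in> ?F" using assms(2) by simp
  ultimately obtain T where "T \<in> ?F" "\<forall>U\<in>?F. T \<subseteq> U \<longrightarrow> T = U"
    using finite_has_maximal[of ?F] by (metis empty_iff)
  then have "mono_component G \<omega> T" "S \<subseteq> T"
    unfolding mono_component_def by auto
  then show ?thesis by (rule that)
qed

text \<open>By uniqueness, the existential over components in \<open>flood_move\<close> can only be
  witnessed by \<open>T\<close>.\<close>

lemma flood_move_component:
  assumes "mono_component G \<omega> T" "v \<in> T"
  shows "flood_move G (v, d) \<omega> u = (if u \<in> T then d else \<omega> u)"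
  using assms mono_component_unique[OF assms(1)] unfolding flood_move_def by auto

section \<open>Existence of a flooding sequence\<close>

lemma ex_floods_to:
  fixes G :: "('a, 'b) pre_digraph" and \<omega> :: "'a \<Rightarrow> 'c"
  assumes G: "finite (verts G)" "Digraph_Component.connected G"
    and "\<forall>v\<in>verts G. \<omega> v \<in> C" "d \<in> C"
  shows "\<exists>ms. floods_to C G \<omega> d ms"
proof -
  \<comment> \<open>The colouring is generalised because each move changes it. Only a monochromatic
    connected set \<open>S\<close> around the fixed \<open>v\<close> is tracked, and the number of
    vertices outside it decreases.\<close>
  have *: "\<exists>ms. floods_to C G \<omega> d ms"
    if "mono_connected G \<omega> S" "v \<in> S" "\<forall>v\<in>verts G. \<omega> v \<in> C" for S v and \<omega> :: "'a \<Rightarrow> 'c"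
    using that
  proof (induction "card (verts G - S)" arbitrary: S \<omega> rule: less_induct)
    case less
    from less.prems have v: "v \<in> verts G" by (auto simp: mono_connected_def)
    obtain T where T: "mono_component G \<omega> T" "S \<subseteq> T"
      using mono_connected_imp_subset_component[OF G(1) less.prems(1)] .
    then have vT: "v \<in> T" and TV: "T \<subseteq> verts G" and conT: "Digraph_Component.connected (G \<restriction> T)"
      using less.prems(2) by (auto simp: mono_component_def mono_connected_def)
    note move = flood_move_component[OF T(1) vT]
    show ?case
    proof (cases "T = verts G")
      case True
      then have "floods_to C G \<omega> d [(v, d)]"
        using v \<open>d \<in> C\<close> by (simp add: floods_to_def move)
      then show ?thesis ..
    next
      case False
      then obtain x y where xy: "x \<in> T" "y \<in> verts G - T" "(x, y) \<in> (arcs_ends G)\<^sup>s"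
        using connected_boundary_edge[OF G(2) TV] vT by blast
      \<comment> \<open>Giving \<open>T\<close> the colour of its outside neighbour \<open>y\<close>
        absorbs \<open>y\<close>, which keeps its own colour.\<close>
      define \<omega>' where "\<omega>' = flood_move G (v, \<omega> y) \<omega>"
      \<comment> \<open>Although \<open>x\<close> is already in \<open>T\<close>, writing
        \<open>{x, y}\<close> presents the set as a union of two overlapping connected sets.\<close>
      have "Digraph_Component.connected (G \<restriction> (T \<union> {x, y}))"
        using conT connected_induce_adjacent[OF xy(3)] xy(1) by (intro connected_induce_Un) auto
      then have mc: "mono_connected G \<omega>' (T \<union> {x, y})"
        using TV xy by (auto simp: mono_connected_def \<omega>'_def move)
      have "card (verts G - (T \<union> {x, y})) < card (verts G - S)"
        using T(2) xy G(1) by (intro psubset_card_mono) auto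
      moreover have "\<forall>v\<in>verts G. \<omega>' v \<in> C"
        using less.prems(3) xy by (auto simp: \<omega>'_def move)
      ultimately obtain ms where "floods_to C G \<omega>' d ms"
        using less.hyps[OF _ mc] vT by blast
      then have "floods_to C G \<omega> d ((v, \<omega> y) # ms)"
        using v xy less.prems(3) by (simp add: floods_to_def \<omega>'_def)
      then show ?thesis ..
    qed
  qed
  obtain v where "v \<in> verts G" using G(2) by (auto simp: connected_conv)
  then have "mono_connected G \<omega> {v}"
    by (auto simp: mono_connected_def connected_induce_singleton)
  then show ?thesis using * assms(3) by blast
qed

section \<open>Counting colours\<close>

lemma colours_flood_move:
  "\<omega> ` V - {\<omega> v} \<subseteq> flood_move G (v, d) \<omega> ` V"
proof
  fix a assume "a \<in> \<omega> ` V - {\<omega> v}"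
  then obtain u where u: "u \<in> V" "a = \<omega> u" "\<omega> u \<noteq> \<omega> v" by blast
  \<comment> \<open>Recoloured vertices share a component with \<open>v\<close>, hence its colour,
    and \<open>u\<close> has another one.\<close>
  then have "flood_move G (v, d) \<omega> u = \<omega> u"
    by (auto simp: flood_move_def mono_component_def mono_connected_def)
  with u show "a \<in> flood_move G (v, d) \<omega> ` V" by (metis image_eqI)
qed

text \<open>Each move loses at most one colour; the \<open>Suc\<close> accounts for the colour
  \<open>d\<close> left at the end.\<close>

lemma card_colours_le_Suc_moves:
  assumes "finite (verts G)" "floods_to C G \<omega> d ms"
  shows "card (\<omega> ` verts G) \<le> Suc (length ms)"
  using assms(2)
proof (induction ms arbitrary: \<omega>)
  case Nil
  then have "\<omega> ` verts G \<subseteq> {d}" by (auto simp: floods_to_def)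
  then have "card (\<omega> ` verts G) \<le> card {d}" by (intro card_mono) auto
  then show ?case by simp
next
  case (Cons m ms)
  obtain v e where m: "m = (v, e)" by force
  have "card (\<omega> ` verts G - {\<omega> v}) \<le> card (flood_move G m \<omega> ` verts G)"
    unfolding m using assms(1) by (intro card_mono colours_flood_move finite_imageI)
  also have "\<dots> \<le> Suc (length ms)"
    using Cons by (simp add: floods_to_def)
  finally show ?case
    by (simp add: card_Diff_singleton_if split: if_splits)
qed

lemma card_colours_le_moves:
  assumes G: "wf_digraph G" "finite (verts G)" "Digraph_Component.connected G"
    and twice: "\<forall>d \<in> \<omega> ` verts G. \<exists>A B. mono_component G \<omega> A \<and> mono_component G \<omega> B \<and> A \<noteq> B \<and>
        (\<forall>u \<in> A. \<omega> u = d) \<and> (\<forall>u \<in> B. \<omega> u = d)"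
    and ms: "floods_to C G \<omega> d ms"
  shows "card (\<omega> ` verts G) \<le> length ms"
proof (cases ms)
  case Nil
  \<comment> \<open>Without moves the colouring is already constant, so the whole graph is the only
    component, contradicting \<open>twice\<close>.\<close>
  then have "mono_connected G \<omega> (verts G)"
    using ms G wf_digraph.induce_verts[OF G(1)] by (auto simp: mono_connected_def floods_to_def)
  then have "A = verts G" if "mono_component G \<omega> A" for A
    using that by (auto simp: mono_component_def mono_connected_def[of G \<omega> A])
  moreover obtain A B where "mono_component G \<omega> A" "mono_component G \<omega> B" "A \<noteq> B"
  proof -
    obtain w where "w \<in> verts G" using G(3) by (auto simp: connected_conv)
    then have "\<omega> w \<in> \<omega> ` verts G" by (rule imageI)
    from bspec[OF twice this] that show ?thesis by blast
  qed
  ultimately show ?thesis by blast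
next
  case (Cons m ms')
  obtain v e where m: "m = (v, e)" by force
  have "v \<in> verts G" using ms Cons m by (simp add: floods_to_def)
  then have "\<omega> v \<in> \<omega> ` verts G" by (rule imageI)
  from bspec[OF twice this]
  \<comment> \<open>At most one of the two components of colour \<open>\<omega> v\<close> contains
    \<open>v\<close>. The other is untouched by the first move and preserves that colour.\<close>
  obtain A where A: "mono_component G \<omega> A" "v \<notin> A" "\<forall>u\<in>A. \<omega> u = \<omega> v"
    by (elim exE conjE) (metis mono_component_unique)
  then obtain u where u: "u \<in> A" "u \<in> verts G"
    by (auto simp: mono_component_def mono_connected_def connected_induce_iff)
  have "flood_move G (v, e) \<omega> u = \<omega> v"
    using A u mono_component_unique[OF A(1)] by (auto simp: flood_move_def)
  then have "\<omega> v \<in> flood_move G m \<omega> ` verts G"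
    using u(2) m by (metis image_eqI)
  then have "\<omega> ` verts G \<subseteq> flood_move G m \<omega> ` verts G"
    using colours_flood_move[of \<omega> "verts G" v G e] unfolding m
    by (simp add: Diff_subset_conv insert_absorb)
  then have "card (\<omega> ` verts G) \<le> card (flood_move G m \<omega> ` verts G)"
    using G(2) by (intro card_mono) auto
  \<comment> \<open>The general bound applied after the first move; its extra one is paid for by
    that move, which lost no colour.\<close>
  also have "\<dots> \<le> Suc (length ms')"
    using ms Cons G(2) by (intro card_colours_le_Suc_moves[where d = d and C = C])
      (auto simp: floods_to_def)
  finally show ?thesis using Cons by simp
qed

text \<open>\<open>Min\<close> is attained because \<open>C\<close> is finite and nonempty, and
  \<open>LEAST\<close> because a flooding sequence exists for every target colour in
  \<open>C\<close>.\<close>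

lemma min_moves_attained:
  fixes G :: "('a, 'b) pre_digraph" and \<omega> :: "'a \<Rightarrow> 'c"
  assumes G: "finite (verts G)" "Digraph_Component.connected G"
    and "finite C" "\<forall>v\<in>verts G. \<omega> v \<in> C"
  obtains d ms where "floods_to C G \<omega> d ms" "length ms = min_moves C G \<omega>"
proof -
  have "C \<noteq> {}" using assms(2,4) by (auto simp: connected_conv)
  then have "min_moves C G \<omega> \<in> min_moves_to C G \<omega> ` C"
    unfolding min_moves_def using \<open>finite C\<close> by (intro Min_in) auto
  then obtain d where d: "d \<in> C" "min_moves C G \<omega> = min_moves_to C G \<omega> d" by blast
  have "\<exists>k ms. length ms = k \<and> floods_to C G \<omega> d ms"
    using ex_floods_to[OF G assms(4) d(1)] by blast
  then have "\<exists>ms. length ms = min_moves C G \<omega> \<and> floods_to C G \<omega> d ms"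
    unfolding d(2) min_moves_to_def by (rule LeastI_ex)
  with that show ?thesis by blast
qed

theorem proposition2p1:
  fixes G :: "('a, 'b) pre_digraph" and C :: "'c set" and \<omega> :: "'a \<Rightarrow> 'c" and c :: nat
  assumes "graph G" and "Digraph_Component.connected G"
    and "finite C" and "\<forall>v \<in> verts G. \<omega> v \<in> C"
    and "card (\<omega> ` verts G) = c"
  shows "int (min_moves C G \<omega>) \<ge> int c - 1 \<and>
    ((\<forall>d \<in> \<omega> ` verts G. \<exists>A B. mono_component G \<omega> A \<and> mono_component G \<omega> B \<and> A \<noteq> B \<and>
        (\<forall>u \<in> A. \<omega> u = d) \<and> (\<forall>u \<in> B. \<omega> u = d))
      \<longrightarrow> min_moves C G \<omega> \<ge> c)"
proof -
  interpret graph G by fact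
  obtain d ms where ms: "floods_to C G \<omega> d ms" "length ms = min_moves C G \<omega>"
    using min_moves_attained[OF finite_verts assms(2-4)] .
  \<comment> \<open>The first bound over the naturals, stated without truncated subtraction.\<close>
  have "c \<le> Suc (min_moves C G \<omega>)"
    using card_colours_le_Suc_moves[OF finite_verts ms(1)] ms(2) assms(5) by simp
  moreover note card_colours_le_moves[OF wf_digraph finite_verts assms(2) _ ms(1)]
  ultimately show ?thesis using ms(2) assms(5) by auto
qed

end
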